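(* Let $A, C \in \mathbb{C}^{n\times n}$ be Hermitian matrices with $C$ indefinite, and for $\mu\in\mathbb{R}$ let $\lambda_1(\mu)\ge\cdots\ge\lambda_n(\mu)$ be the $n$ sorted eigenvalues of $A-\mu C$. Then $$\min_{\mu\in\mathbb{R}}\lambda_1(\mu)=\max_{\substack{x\in\mathbb{C}^n,\ x\neq0\\ x^HCx=0}}\rho_A(x)\quad\text{and}\quad \max_{\mu\in\mathbb{R}}\lambda_n(\mu)=\min_{\substack{x\in\mathbb{C}^n,\ x\neq0\\ x^HCx=0}}\rho_A(x),$$ where $\rho_A(x)=x^HAx/(x^Hx)$.
   Context: A Hermitian matrix is indefinite if it has at least one positive and at least one negative eigenvalue. Eigenvalues are counted with multiplicity. *)

theory Defs
  imports "Jordan_Normal_Form.Schur_Decomposition"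
    "HOL-Computational_Algebra.Fundamental_Theorem_Algebra"
begin

definition hermitian_mat :: "complex mat \<Rightarrow> bool" where
  "hermitian_mat M \<longleftrightarrow> mat_adjoint M = M"

definition indefinite_mat :: "complex mat \<Rightarrow> bool" where
  "indefinite_mat M \<longleftrightarrow>
     (\<exists>a::real. a > 0 \<and> eigenvalue M (complex_of_real a)) \<and>
     (\<exists>b::real. b < 0 \<and> eigenvalue M (complex_of_real b))"

text \<open>\<open>x\<^sup>H M x\<close>; the library product \<open>\<bullet>\<close> is bilinear, so the left argument is conjugated.\<close>

definition quad_form :: "complex mat \<Rightarrow> complex vec \<Rightarrow> complex" where
  "quad_form M x = conjugate x \<bullet> (M *\<^sub>v x)"

text \<open>\<open>x\<^sup>H M x / x\<^sup>H x\<close>. The real part only changes the type: the quotient is real for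
  Hermitian \<open>M\<close>, see \<open>of_real_rayleigh\<close> below.\<close>

definition rayleigh :: "complex mat \<Rightarrow> complex vec \<Rightarrow> real" where
  "rayleigh M x = Re (quad_form M x / (conjugate x \<bullet> x))"

text \<open>The eigenvalues with algebraic multiplicity, in nonincreasing order. Taking real parts loses
  nothing for Hermitian \<open>M\<close>, see \<open>mset_sorted_eigvals\<close> below.\<close>

definition sorted_eigvals :: "complex mat \<Rightarrow> real list" where
  "sorted_eigvals M = rev (sorted_list_of_multiset (image_mset Re (proots (char_poly M))))"

text \<open>The \<open>k\<close>-th largest eigenvalue, counted from \<open>k = 1\<close>.\<close>

definition eigval :: "nat \<Rightarrow> complex mat \<Rightarrow> real" where
  "eigval k M = sorted_eigvals M ! (k - 1)"

lemma hermitian_mat_iff: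
  assumes "M \<in> carrier_mat n n"
  shows "hermitian_mat M \<longleftrightarrow> (\<forall>i<n. \<forall>j<n. cnj (M $$ (j, i)) = M $$ (i, j))"
  using assms
  by (auto simp: hermitian_mat_def mat_adjoint_def mat_of_rows_def mat_eq_iff)

lemma quad_form_sum:
  assumes "M \<in> carrier_mat n n" "x \<in> carrier_vec n"
  shows "quad_form M x = (\<Sum>i<n. \<Sum>j<n. cnj (x $ i) * M $$ (i, j) * x $ j)"
  using assms
  by (auto simp: quad_form_def scalar_prod_def sum_distrib_left mult.assoc atLeast0LessThan
      intro!: sum.cong)

lemma quad_form_real:
  assumes M: "M \<in> carrier_mat n n" "hermitian_mat M" and x: "x \<in> carrier_vec n"
  shows "quad_form M x \<in> \<real>"
proof -
  have "cnj (quad_form M x) = (\<Sum>i<n. \<Sum>j<n. x $ i * cnj (M $$ (i, j)) * cnj (x $ j))"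
    by (simp add: quad_form_sum[OF M(1) x])
  also have "\<dots> = (\<Sum>i<n. \<Sum>j<n. x $ i * M $$ (j, i) * cnj (x $ j))"
    using M by (intro sum.cong refl) (auto simp: hermitian_mat_iff)
  also have "\<dots> = (\<Sum>j<n. \<Sum>i<n. x $ i * M $$ (j, i) * cnj (x $ j))"
    by (rule sum.swap)
  also have "\<dots> = quad_form M x"
    by (simp add: quad_form_sum[OF M(1) x] mult_ac)
  finally show ?thesis by (simp add: Reals_cnj_iff)
qed

lemma conjugate_scalar_prod_self:
  assumes "x \<in> carrier_vec n"
  shows "conjugate x \<bullet> x = complex_of_real (\<Sum>i<n. (cmod (x $ i))\<^sup>2)"
  using assms
  by (auto simp: scalar_prod_def atLeast0LessThan complex_norm_square[symmetric, unfolded of_real_power] mult.commute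
      intro!: sum.cong)

lemma of_real_rayleigh:
  assumes "M \<in> carrier_mat n n" "hermitian_mat M" "x \<in> carrier_vec n"
  shows "complex_of_real (rayleigh M x) = quad_form M x / (conjugate x \<bullet> x)"
proof -
  have "quad_form M x / (conjugate x \<bullet> x) \<in> \<real>"
    using quad_form_real[OF assms] conjugate_scalar_prod_self[OF assms(3)]
    by (metis Reals_divide Reals_of_real)
  thus ?thesis by (simp add: rayleigh_def)
qed

lemma eigenvalue_hermitian_real:
  assumes M: "M \<in> carrier_mat n n" "hermitian_mat M" and ev: "eigenvalue M a"
  shows "a \<in> \<real>"
proof -
  from ev M obtain x where x: "x \<in> carrier_vec n" "x \<noteq> 0\<^sub>v n" and eq: "M *\<^sub>v x = a \<cdot>\<^sub>v x"
    by (auto simp: eigenvalue_def eigenvector_def)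
  have "quad_form M x = a * (conjugate x \<bullet> x)"
    using x eq by (auto simp: quad_form_def)
  moreover have "conjugate x \<bullet> x \<noteq> 0"
    using x by (metis conjugate_square_eq_0_vec conjugate_vec_sprod_comm)
  ultimately have "a = complex_of_real (rayleigh M x)"
    using of_real_rayleigh[OF M x(1)] by simp
  thus ?thesis by simp
qed

lemma mset_sorted_eigvals:
  assumes M: "M \<in> carrier_mat n n" "hermitian_mat M"
  shows "image_mset complex_of_real (mset (sorted_eigvals M)) = proots (char_poly M)"
proof -
  have nz: "char_poly M \<noteq> 0"
    using degree_monic_char_poly[OF M(1)] by auto
  have "image_mset (complex_of_real \<circ> Re) (proots (char_poly M))
      = image_mset id (proots (char_poly M))"
  proof (rule image_mset_cong)
    fix a assume "a \<in># proots (char_poly M)"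
    hence "eigenvalue M a" using nz by (simp add: eigenvalue_root_char_poly[OF M(1)])
    thus "(complex_of_real \<circ> Re) a = id a"
      using eigenvalue_hermitian_real[OF M] by auto
  qed
  thus ?thesis by (simp add: sorted_eigvals_def multiset.map_comp)
qed

lemma length_sorted_eigvals:
  assumes "M \<in> carrier_mat n n"
  shows "length (sorted_eigvals M) = n"
proof -
  have "length (sorted_eigvals M) = size (mset (sorted_eigvals M))" by simp
  also have "\<dots> = size (proots (char_poly M))"
    unfolding sorted_eigvals_def by (simp del: size_mset)
  also have "\<dots> = n"
    using degree_monic_char_poly[OF assms] by (simp add: size_proots_complex)
  finally show ?thesis .
qed

lemma sorted_sorted_eigvals: "sorted_wrt (\<ge>) (sorted_eigvals M)"
  by (simp add: sorted_eigvals_def sorted_wrt_rev)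

end

(*
Weak duality: if x^H C x = 0 then the Rayleigh quotients of A and A - mu C agree at x, so
rho_A(x) <= lambda_1(mu) for every mu. For equality, let m be the maximum of rho_A over the
isotropic vectors of C (attained by compactness). Then B = A - m I is nonpositive on those vectors,
and a homogeneous S-lemma yields mu with B <= mu C as forms, i.e. lambda_1(mu) <= m. The second
half is the first one applied to -A.
*)

theory Submission
  imports
    "HOL-Analysis.Function_Topology"
    "HOL-Analysis.Topology_Euclidean_Space"
    Defs
begin

section \<open>Hermitian forms and the squared norm on complex vectors\<close>

definition sesq :: "complex mat \<Rightarrow> complex vec \<Rightarrow> complex vec \<Rightarrow> complex" where
  "sesq M x y = conjugate x \<bullet> (M *\<^sub>v y)"

text \<open>Real-valued so that forms can be compared and divided as reals; for Hermitian
  \<open>M\<close> nothing is lost, see \<open>quad_form_hform\<close>.\<close>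

definition hform :: "complex mat \<Rightarrow> complex vec \<Rightarrow> real" where
  "hform M x = Re (quad_form M x)"

definition sqnorm :: "complex vec \<Rightarrow> real" where
  "sqnorm x = (\<Sum>i<dim_vec x. (cmod (x $ i))\<^sup>2)"

lemma sesq_sum:
  assumes "M \<in> carrier_mat n n" "x \<in> carrier_vec n" "y \<in> carrier_vec n"
  shows "sesq M x y = (\<Sum>i<n. \<Sum>j<n. cnj (x $ i) * M $$ (i, j) * y $ j)"
  using assms
  by (auto simp: sesq_def scalar_prod_def sum_distrib_left mult.assoc atLeast0LessThan
      intro!: sum.cong)

lemma sesq_swap:
  assumes M: "M \<in> carrier_mat n n" "hermitian_mat M"
    and xy: "x \<in> carrier_vec n" "y \<in> carrier_vec n"
  shows "sesq M y x = cnj (sesq M x y)"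
proof -
  have "sesq M y x = (\<Sum>j<n. \<Sum>i<n. cnj (y $ j) * cnj (M $$ (i, j)) * x $ i)"
    using M xy by (auto simp: sesq_sum hermitian_mat_iff intro!: sum.cong)
  also have "\<dots> = (\<Sum>i<n. \<Sum>j<n. cnj (y $ j) * cnj (M $$ (i, j)) * x $ i)"
    by (rule sum.swap)
  also have "\<dots> = cnj (sesq M x y)"
    using M xy by (simp add: sesq_sum mult_ac)
  finally show ?thesis .
qed

lemma quad_form_hform:
  assumes "M \<in> carrier_mat n n" "hermitian_mat M" "x \<in> carrier_vec n"
  shows "quad_form M x = complex_of_real (hform M x)"
  using quad_form_real[OF assms] by (simp add: hform_def)

text \<open>Polarization: by \<open>sesq_swap\<close> the two cross terms are conjugate, so they
  merge into twice a real part.\<close>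

lemma hform_add_smult:
  assumes M: "M \<in> carrier_mat n n" "hermitian_mat M"
    and yz: "y \<in> carrier_vec n" "z \<in> carrier_vec n"
  shows "hform M (y + c \<cdot>\<^sub>v z)
    = hform M y + 2 * Re (c * sesq M y z) + (cmod c)\<^sup>2 * hform M z"
proof -
  have "quad_form M (y + c \<cdot>\<^sub>v z)
      = quad_form M y + c * sesq M y z + cnj c * sesq M z y + (cnj c * c) * quad_form M z"
    using M(1) yz
    by (simp add: quad_form_sum sesq_sum algebra_simps sum.distrib sum_distrib_left)
  moreover have "cnj c * c = complex_of_real ((cmod c)\<^sup>2)"
    using complex_norm_square[of c] by (simp add: mult.commute)
  ultimately show ?thesis
    using sesq_swap[OF M yz] by (simp add: hform_def)
qed

lemma hform_minus_smult:
  assumes "A \<in> carrier_mat n n" "C \<in> carrier_mat n n" "x \<in> carrier_vec n"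
  shows "hform (A - complex_of_real r \<cdot>\<^sub>m C) x = hform A x - r * hform C x"
proof -
  have "A - complex_of_real r \<cdot>\<^sub>m C \<in> carrier_mat n n"
    using assms by (intro minus_carrier_mat smult_carrier_mat)
  hence "quad_form (A - complex_of_real r \<cdot>\<^sub>m C) x = quad_form A x - r * quad_form C x"
    using assms
    by (simp add: quad_form_sum algebra_simps sum_subtractf sum_distrib_left)
  thus ?thesis by (simp add: hform_def)
qed

lemma hform_one:
  assumes "x \<in> carrier_vec n"
  shows "hform (1\<^sub>m n) x = sqnorm x"
  using assms conjugate_scalar_prod_self[OF assms]
  by (simp add: hform_def quad_form_def sqnorm_def)

lemma hform_uminus:
  assumes "A \<in> carrier_mat n n" "x \<in> carrier_vec n"
  shows "hform (- A) x = - hform A x"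
  using assms by (simp add: hform_def quad_form_sum sum_negf)

lemma hform_smult_vec:
  assumes "A \<in> carrier_mat n n" "x \<in> carrier_vec n"
  shows "hform A (c \<cdot>\<^sub>v x) = (cmod c)\<^sup>2 * hform A x"
proof -
  have "quad_form A (c \<cdot>\<^sub>v x) = (c * cnj c) * quad_form A x"
    using assms by (simp add: quad_form_sum sum_distrib_left mult_ac)
  thus ?thesis by (simp add: hform_def flip: complex_norm_square)
qed

lemma sqnorm_smult: "sqnorm (c \<cdot>\<^sub>v x) = (cmod c)\<^sup>2 * sqnorm x"
  by (simp add: sqnorm_def norm_mult power_mult_distrib sum_distrib_left)

lemma sqnorm_pos:
  assumes "x \<in> carrier_vec n" "x \<noteq> 0\<^sub>v n"
  shows "sqnorm x > 0"
proof -
  obtain i where "i < n" "x $ i \<noteq> 0"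
    using assms by (auto simp: vec_eq_iff)
  thus ?thesis
    using assms unfolding sqnorm_def by (intro sum_pos2[of _ i]) auto
qed

lemma sqnorm_zero: "sqnorm (0\<^sub>v n) = 0"
  by (simp add: sqnorm_def)

lemma hform_zero:
  assumes "M \<in> carrier_mat n n"
  shows "hform M (0\<^sub>v n) = 0"
  using assms by (simp add: hform_def quad_form_sum)

lemma rayleigh_hform:
  assumes "x \<in> carrier_vec n"
  shows "rayleigh M x = hform M x / sqnorm x"
  using assms conjugate_scalar_prod_self[OF assms]
  by (simp add: rayleigh_def hform_def sqnorm_def del: of_real_sum)

lemma hermitian_minus_smult:
  assumes "A \<in> carrier_mat n n" "C \<in> carrier_mat n n" "hermitian_mat A" "hermitian_mat C"
  shows "hermitian_mat (A - complex_of_real r \<cdot>\<^sub>m C)"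
proof -
  have "A - complex_of_real r \<cdot>\<^sub>m C \<in> carrier_mat n n"
    using assms by (intro minus_carrier_mat smult_carrier_mat)
  thus ?thesis using assms by (auto simp: hermitian_mat_iff)
qed

lemma hermitian_one: "hermitian_mat (1\<^sub>m n)"
  by (auto simp: hermitian_mat_iff[of _ n])

lemma hermitian_uminus:
  assumes "A \<in> carrier_mat n n" "hermitian_mat A"
  shows "hermitian_mat (- A)"
proof -
  have "- A \<in> carrier_mat n n" using assms by simp
  thus ?thesis using assms by (auto simp: hermitian_mat_iff)
qed

section \<open>Attaining the maximal Rayleigh quotient on isotropic vectors\<close>

text \<open>Tychonoff: each factor is a closed ball or a point. Vectors are modelled as functions of
  the index that vanish from \<open>n\<close> on, which puts the product topology at their
  disposal.\<close>

lemma compact_PiE_bounded: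
  fixes r :: real
  shows "compact (\<Pi>\<^sub>E i\<in>UNIV. if i < n then cball 0 r else {0::complex})"
proof -
  have "compactin (product_topology (\<lambda>_. euclidean) UNIV)
      (\<Pi>\<^sub>E i\<in>UNIV. if i < n then cball 0 r else {0::complex})"
    by (subst compactin_PiE) (auto simp: compactin_euclidean_iff)
  thus ?thesis
    by (simp add: euclidean_product_topology compactin_euclidean_iff)
qed

lemma continuous_on_hform_vec:
  assumes "M \<in> carrier_mat n n"
  shows "continuous_on UNIV (\<lambda>f. hform M (vec n f))"
  using assms
  by (simp add: hform_def quad_form_sum) (intro continuous_intros continuous_on_product_coordinates)

text \<open>All forms scale by \<open>(cmod c)\<^sup>2\<close>, so it suffices to maximize over
  isotropic unit vectors, a compact set; \<open>x0\<close> makes it nonempty. The bound is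
  multiplied out so that it also covers \<open>y = 0\<close>.\<close>

lemma rayleigh_attains_max:
  assumes A: "A \<in> carrier_mat n n" and C: "C \<in> carrier_mat n n"
    and x0: "x0 \<in> carrier_vec n" "x0 \<noteq> 0\<^sub>v n" "hform C x0 = 0"
  obtains x where "x \<in> carrier_vec n" "x \<noteq> 0\<^sub>v n" "hform C x = 0"
    and "\<And>y. y \<in> carrier_vec n \<Longrightarrow> hform C y = 0 \<Longrightarrow> hform A y \<le> rayleigh A x * sqnorm y"
proof -
  \<comment> \<open>The isotropic unit sphere as a closed part of a compact box: the entries of a
    unit vector lie in the unit disc.\<close>
  define K where "K = (\<Pi>\<^sub>E i\<in>UNIV. if i < n then cball 0 1 else {0::complex})
    \<inter> ({f. sqnorm (vec n f) = 1} \<inter> {f. hform C (vec n f) = 0})"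
  have "continuous_on UNIV (\<lambda>f. sqnorm (vec n f))"
    using continuous_on_hform_vec[of "1\<^sub>m n" n] by (simp add: hform_one[of _ n])
  hence "compact K"
    unfolding K_def
    by (intro compact_Int_closed compact_PiE_bounded closed_Int closed_Collect_eq
        continuous_on_hform_vec[OF C] continuous_on_const)
  have normalized: "\<exists>f\<in>K. vec n f = complex_of_real (1 / sqrt (sqnorm y)) \<cdot>\<^sub>v y"
    if y: "y \<in> carrier_vec n" "y \<noteq> 0\<^sub>v n" "hform C y = 0" for y
  proof -
    let ?z = "complex_of_real (1 / sqrt (sqnorm y)) \<cdot>\<^sub>v y"
    define f where "f i = (if i < n then ?z $ i else 0)" for i
    have z: "vec n f = ?z" using y by (auto simp: f_def)
    have s: "sqnorm ?z = 1"
      using sqnorm_pos[OF y(1,2)]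
      by (simp add: sqnorm_smult power_divide del: of_real_divide)
    have "cmod (?z $ i) \<le> 1" if "i < n" for i
    proof -
      have "(cmod (?z $ i))\<^sup>2 \<le> sqnorm ?z"
        unfolding sqnorm_def using y that
        by (intro member_le_sum) auto
      thus ?thesis using s by (simp add: abs_square_le_1 del: index_smult_vec)
    qed
    hence "f \<in> K"
      using z s y C hform_smult_vec[OF C y(1), of "complex_of_real (1 / sqrt (sqnorm y))"]
      by (auto simp: K_def f_def mem_cball_0 simp del: index_smult_vec of_real_divide)
    thus ?thesis using z by blast
  qed
  have "K \<noteq> {}" using normalized[OF x0] by blast
  then obtain f where f: "f \<in> K" and max: "\<And>g. g \<in> K \<Longrightarrow> hform A (vec n g) \<le> hform A (vec n f)"
    using continuous_attains_sup[OF \<open>compact K\<close>, of "\<lambda>f. hform A (vec n f)"]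
      continuous_on_subset[OF continuous_on_hform_vec[OF A]] by blast
  let ?x = "vec n f"
  have fx: "sqnorm ?x = 1" "hform C ?x = 0" using f by (auto simp: K_def)
  show ?thesis
  proof (rule that[of ?x])
    show "?x \<noteq> 0\<^sub>v n" using fx by (auto simp: sqnorm_zero)
    fix y assume y: "y \<in> carrier_vec n" "hform C y = 0"
    show "hform A y \<le> rayleigh A ?x * sqnorm y"
    proof (cases "y = 0\<^sub>v n")
      case True
      thus ?thesis using A by (simp add: sqnorm_zero hform_zero)
    next
      case False
      from normalized[OF y(1) False y(2)] obtain g
        where g: "g \<in> K" "vec n g = complex_of_real (1 / sqrt (sqnorm y)) \<cdot>\<^sub>v y" by blast
      have "hform A y / sqnorm y = hform A (vec n g)"
        using sqnorm_pos[OF y(1) False] 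
          hform_smult_vec[OF A y(1), of "complex_of_real (1 / sqrt (sqnorm y))"]
        by (simp add: g(2) power_divide del: of_real_divide)
      also have "\<dots> \<le> rayleigh A ?x"
        using max[OF g(1)] fx by (simp add: rayleigh_hform[of _ n])
      finally show ?thesis
        using sqnorm_pos[OF y(1) False] by (simp add: field_simps)
    qed
  qed (use fx in auto)
qed

section \<open>Eigenvalues and values of the form\<close>

text \<open>Links the variational side to the spectrum: first-order optimality of a maximizer is the
  eigenvalue equation.\<close>

lemma max_hform_eigenvector:
  assumes M: "M \<in> carrier_mat n n" "hermitian_mat M"
    and x: "x \<in> carrier_vec n" "x \<noteq> 0\<^sub>v n" "hform M x = m * sqnorm x"
    and max: "\<And>y. y \<in> carrier_vec n \<Longrightarrow> hform M y \<le> m * sqnorm y"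
  shows "eigenvalue M (complex_of_real m)"
proof -
  define N where "N = M - complex_of_real m \<cdot>\<^sub>m 1\<^sub>m n"
  have N: "N \<in> carrier_mat n n" "hermitian_mat N"
    using M hermitian_minus_smult[OF M(1) one_carrier_mat M(2) hermitian_one]
    by (auto simp: N_def)
  have hN: "hform N y = hform M y - m * sqnorm y" if "y \<in> carrier_vec n" for y
    using hform_minus_smult[OF M(1) one_carrier_mat that] that
    by (simp add: N_def hform_one)
  \<comment> \<open>\<open>N\<close> is negative semidefinite with \<open>x\<^sup>H N x = 0\<close>; perturbing \<open>x\<close> towards \<open>N x\<close> forces \<open>N x = 0\<close>\<close>
  define y where "y = N *\<^sub>v x"
  have y: "y \<in> carrier_vec n" using N x by (simp add: y_def)
  \<comment> \<open>Moving along \<open>N x\<close> is the right choice because the cross term is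
    then the squared length of \<open>N x\<close> itself.\<close>
  have "sesq N y x = complex_of_real (sqnorm y)"
    using conjugate_scalar_prod_self[OF y] y
    by (simp add: sesq_def sqnorm_def flip: y_def)
  hence s: "sesq N x y = complex_of_real (sqnorm y)"
    using sesq_swap[OF N x(1) y] by (metis complex_cnj_cnj complex_cnj_complex_of_real)
  have le: "2 * sqnorm y + t * hform N y \<le> 0" if "t > 0" for t :: real
  proof -
    have "hform N (x + complex_of_real t \<cdot>\<^sub>v y) \<le> 0"
      using hN max x y by simp
    hence "t * (2 * sqnorm y + t * hform N y) \<le> 0"
      using hform_add_smult[OF N x(1) y, of "complex_of_real t"] s hN[OF x(1)] x(3)
      by (simp add: algebra_simps power2_eq_square)
    thus ?thesis using that by (simp add: mult_le_0_iff)
  qed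
  \<comment> \<open>As \<open>t\<close> tends to 0 from the right the second-order term vanishes,
    which leaves \<open>2 * sqnorm y \<le> 0\<close>.\<close>
  have "((\<lambda>t. 2 * sqnorm y + t * hform N y) \<longlongrightarrow> 2 * sqnorm y + 0 * hform N y) (at_right 0)"
    by (intro tendsto_intros)
  hence "2 * sqnorm y + 0 * hform N y \<le> 0"
    by (rule tendsto_upperbound) (auto intro!: eventually_at_rightI[of 0 1] le simp del: mult_le_0_iff)
  hence "y = 0\<^sub>v n" using sqnorm_pos[OF y] by fastforce
  moreover have "(complex_of_real m \<cdot>\<^sub>m 1\<^sub>m n) *\<^sub>v x = complex_of_real m \<cdot>\<^sub>v x"
    using x by (auto simp: vec_eq_iff)
  ultimately have "M *\<^sub>v x - complex_of_real m \<cdot>\<^sub>v x = 0\<^sub>v n"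
    using M x by (simp add: y_def N_def minus_mult_distrib_mat_vec)
  hence "M *\<^sub>v x = complex_of_real m \<cdot>\<^sub>v x"
    using M x by (auto simp: vec_eq_iff)
  thus ?thesis
    using M x by (auto simp: eigenvalue_def eigenvector_def)
qed

lemma hform_eigenvector:
  assumes "M \<in> carrier_mat n n" "eigenvalue M (complex_of_real a)"
  obtains x where "x \<in> carrier_vec n" "x \<noteq> 0\<^sub>v n" "hform M x = a * sqnorm x"
proof -
  obtain x where x: "x \<in> carrier_vec n" "x \<noteq> 0\<^sub>v n" "M *\<^sub>v x = complex_of_real a \<cdot>\<^sub>v x"
    using assms by (auto simp: eigenvalue_def eigenvector_def)
  have "hform M x = a * sqnorm x"
    using x conjugate_scalar_prod_self[OF x(1)]
    by (simp add: hform_def quad_form_def sqnorm_def del: of_real_sum)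
  thus ?thesis using that x by blast
qed


section \<open>Isotropic vectors and the homogeneous S-lemma\<close>

text \<open>Rotating \<open>z\<close> by a phase makes the cross term of \<open>C\<close> purely imaginary, so that it disappears
  for both signs of \<open>c\<close>.\<close>

lemma isotropic_pair:
  assumes C: "C \<in> carrier_mat n n" "hermitian_mat C"
    and y: "y \<in> carrier_vec n" "hform C y > 0"
    and z: "z \<in> carrier_vec n" "hform C z < 0"
  obtains c where "(cmod c)\<^sup>2 = - hform C y / hform C z"
    and "hform C (y + c \<cdot>\<^sub>v z) = 0" and "hform C (y + (- c) \<cdot>\<^sub>v z) = 0"
proof -
  define h where "h = sesq C y z"
  define s where "s = (if h = 0 then 1 else \<i> * cnj h / complex_of_real (cmod h))"
  have s: "cmod s = 1" by (simp add: s_def norm_divide norm_mult)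
  have "s * h = \<i> * complex_of_real (cmod h)"
    using complex_norm_square[of h]
    by (auto simp: s_def field_simps power2_eq_square)
  hence re: "Re (s * h) = 0" by simp
  \<comment> \<open>Once the cross term is gone, this modulus makes
    \<open>(cmod c)\<^sup>2 * hform C z\<close> cancel \<open>hform C y\<close>; the opposite signs
    make the radicand positive.\<close>
  define t where "t = sqrt (- hform C y / hform C z)"
  have pos: "- hform C y / hform C z > 0"
    using y z by (simp add: divide_pos_neg)
  define c where "c = complex_of_real t * s"
  have c2: "(cmod c)\<^sup>2 = - hform C y / hform C z"
    using pos s by (simp add: c_def norm_mult t_def)
  have "Re (c * h) = t * Re (s * h)" by (simp add: c_def algebra_simps)
  hence "Re (c * h) = 0" using re by simp
  hence "hform C (y + c \<cdot>\<^sub>v z) = 0" "hform C (y + (- c) \<cdot>\<^sub>v z) = 0"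
    unfolding hform_add_smult[OF C y(1) z(1)] norm_minus_cancel c2
    using z by (auto simp flip: h_def)
  thus ?thesis using that c2 by blast
qed

text \<open>One vector of the pair from \<open>isotropic_pair\<close> suffices. If it were zero,
  \<open>y\<close> would be a multiple of \<open>z\<close>, and \<open>hform C y\<close> could not
  be positive.\<close>

lemma isotropic_exists:
  assumes C: "C \<in> carrier_mat n n" "hermitian_mat C"
    and y: "y \<in> carrier_vec n" "hform C y > 0"
    and z: "z \<in> carrier_vec n" "hform C z < 0"
  obtains x where "x \<in> carrier_vec n" "x \<noteq> 0\<^sub>v n" "hform C x = 0"
proof -
  obtain c where c: "hform C (y + c \<cdot>\<^sub>v z) = 0"
    using isotropic_pair[OF C y z] by blast
  have "y + c \<cdot>\<^sub>v z \<noteq> 0\<^sub>v n"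
  proof
    assume eq: "y + c \<cdot>\<^sub>v z = 0\<^sub>v n"
    have "y = (- c) \<cdot>\<^sub>v z"
    proof (rule eq_vecI)
      fix i assume "i < dim_vec ((- c) \<cdot>\<^sub>v z)"
      hence "i < n" using z by simp
      hence "(y + c \<cdot>\<^sub>v z) $ i = 0" using eq by simp
      thus "y $ i = ((- c) \<cdot>\<^sub>v z) $ i"
        using y z \<open>i < n\<close> by (simp add: add_eq_0_iff2)
    qed (use y z in auto)
    hence "hform C y = (cmod c)\<^sup>2 * hform C z"
      using hform_smult_vec[OF C(1) z(1), of "- c"] by simp
    also have "\<dots> \<le> 0" using z by (simp add: mult_le_0_iff)
    finally show False using y by simp
  qed
  thus ?thesis using c y z by (intro that[of "y + c \<cdot>\<^sub>v z"]) auto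
qed

text \<open>Where \<open>hform C\<close> is positive, the claim bounds \<open>\<mu>\<close> from
  below by the quotient of the forms; where it is negative, from above. A common
  \<open>\<mu>\<close> exists because no lower bound exceeds an upper one.\<close>

lemma S_lemma_homogeneous:
  assumes B: "B \<in> carrier_mat n n" "hermitian_mat B"
    and C: "C \<in> carrier_mat n n" "hermitian_mat C"
    and y0: "y0 \<in> carrier_vec n" "hform C y0 > 0"
    and z0: "z0 \<in> carrier_vec n" "hform C z0 < 0"
    and nonpos: "\<And>x. x \<in> carrier_vec n \<Longrightarrow> hform C x = 0 \<Longrightarrow> hform B x \<le> 0"
  obtains \<mu> where "\<And>x. x \<in> carrier_vec n \<Longrightarrow> hform B x \<le> \<mu> * hform C x"
proof -
  have slopes: "hform B y / hform C y \<le> hform B z / hform C z"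
    if y: "y \<in> carrier_vec n" "hform C y > 0" and z: "z \<in> carrier_vec n" "hform C z < 0" for y z
  proof -
    obtain c where c: "(cmod c)\<^sup>2 = - hform C y / hform C z"
      "hform C (y + c \<cdot>\<^sub>v z) = 0" "hform C (y + (- c) \<cdot>\<^sub>v z) = 0"
      using isotropic_pair[OF C y z] by blast
    have "hform B (y + c \<cdot>\<^sub>v z) \<le> 0" "hform B (y + (- c) \<cdot>\<^sub>v z) \<le> 0"
      using c y z by (auto intro!: nonpos)
    \<comment> \<open>adding the two inequalities cancels the cross term of \<open>B\<close>\<close>
    hence "hform B y + (cmod c)\<^sup>2 * hform B z \<le> 0"
      by (simp add: hform_add_smult[OF B y(1) z(1)])
    \<comment> \<open>Inserting the value of \<open>(cmod c)\<^sup>2\<close> and dividing by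
      \<open>hform C y > 0\<close> gives the comparison of quotients.\<close>
    thus ?thesis using y z unfolding c(1) by (simp add: field_simps)
  qed
  \<comment> \<open>The lower bounds on \<open>\<mu>\<close>: \<open>y0\<close> supplies one and
    \<open>z0\<close> bounds them all, so the supremum exists and satisfies every
    constraint.\<close>
  define S where "S = (\<lambda>y. hform B y / hform C y) ` {y \<in> carrier_vec n. hform C y > 0}"
  have S: "S \<noteq> {}" "bdd_above S"
    using y0 slopes[OF _ _ z0] by (auto simp: S_def intro!: bdd_aboveI)
  show ?thesis
  proof (rule that[of "Sup S"])
    fix x :: "complex vec" assume x: "x \<in> carrier_vec n"
    consider "hform C x = 0" | "hform C x > 0" | "hform C x < 0" by linarith
    thus "hform B x \<le> Sup S * hform C x"
    proof cases
      case 1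
      thus ?thesis using nonpos[OF x] by simp
    next
      case 2
      hence "hform B x / hform C x \<le> Sup S"
        using x S by (intro cSup_upper) (auto simp: S_def)
      thus ?thesis using 2 by (simp add: field_simps)
    next
      case 3
      hence "Sup S \<le> hform B x / hform C x"
        using x S slopes by (intro cSup_least) (auto simp: S_def)
      thus ?thesis using 3 by (simp add: field_simps)
    qed
  qed
qed

section \<open>Extreme eigenvalues and the Rayleigh bound\<close>

lemma set_sorted_eigvals:
  assumes M: "M \<in> carrier_mat n n" "hermitian_mat M"
  shows "set (sorted_eigvals M) = {a. eigenvalue M (complex_of_real a)}"
proof -
  have "char_poly M \<noteq> 0"
    using degree_monic_char_poly[OF M(1)] by auto
  hence "complex_of_real ` set (sorted_eigvals M) = {a. eigenvalue M a}"
    using arg_cong[OF mset_sorted_eigvals[OF M], of set_mset]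
    by (simp add: eigenvalue_root_char_poly[OF M(1)])
  thus ?thesis
    by (metis (no_types, lifting) Collect_cong inj_image_mem_iff inj_of_real mem_Collect_eq
        Collect_mem_eq)
qed

lemma eigval_first:
  assumes M: "M \<in> carrier_mat n n" "hermitian_mat M" and "n > 0"
  shows "eigenvalue M (complex_of_real (eigval 1 M))"
    and "eigenvalue M (complex_of_real a) \<Longrightarrow> a \<le> eigval 1 M"
proof -
  note len = length_sorted_eigvals[OF M(1)] and set = set_sorted_eigvals[OF M]
  show "eigenvalue M (complex_of_real (eigval 1 M))"
    using nth_mem[of 0 "sorted_eigvals M"] len \<open>n > 0\<close> set by (auto simp: eigval_def)
  assume "eigenvalue M (complex_of_real a)"
  then obtain i where i: "i < n" "a = sorted_eigvals M ! i"
    using set len by (metis (mono_tags, lifting) in_set_conv_nth mem_Collect_eq)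
  thus "a \<le> eigval 1 M"
    \<comment> \<open>Sortedness compares only distinct positions, so position 0, which is
      \<open>eigval 1\<close>, is split off.\<close>
    using sorted_wrt_nth_less[OF sorted_sorted_eigvals, of 0 i M] len
    by (cases "i = 0") (auto simp: eigval_def)
qed

lemma eigval_last:
  assumes M: "M \<in> carrier_mat n n" "hermitian_mat M" and "n > 0"
  shows "eigenvalue M (complex_of_real (eigval n M))"
    and "eigenvalue M (complex_of_real a) \<Longrightarrow> eigval n M \<le> a"
proof -
  note len = length_sorted_eigvals[OF M(1)] and set = set_sorted_eigvals[OF M]
  show "eigenvalue M (complex_of_real (eigval n M))"
    using nth_mem[of "n - 1" "sorted_eigvals M"] len \<open>n > 0\<close> set by (auto simp: eigval_def)
  assume "eigenvalue M (complex_of_real a)"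
  then obtain i where i: "i < n" "a = sorted_eigvals M ! i"
    using set len by (metis (mono_tags, lifting) in_set_conv_nth mem_Collect_eq)
  thus "eigval n M \<le> a"
    using sorted_wrt_nth_less[OF sorted_sorted_eigvals, of i "n - 1" M] len
    by (cases "i = n - 1") (auto simp: eigval_def)
qed

lemma eigenvalue_uminus:
  fixes M :: "complex mat"
  assumes M: "M \<in> carrier_mat n n" and "eigenvalue M a"
  shows "eigenvalue (- M) (- a)"
proof -
  obtain x where x: "x \<in> carrier_vec n" "x \<noteq> 0\<^sub>v n" "M *\<^sub>v x = a \<cdot>\<^sub>v x"
    using assms by (auto simp: eigenvalue_def eigenvector_def)
  have "- M *\<^sub>v x = - (M *\<^sub>v x)"
    using M x by (auto simp: vec_eq_iff)
  hence "- M *\<^sub>v x = (- a) \<cdot>\<^sub>v x"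
    using x by (auto simp: vec_eq_iff)
  thus ?thesis
    using M x by (auto simp: eigenvalue_def eigenvector_def)
qed

text \<open>Negation carries the spectrum of \<open>M\<close> onto that of \<open>- M\<close>. Each
  inequality tests the extreme eigenvalue of one matrix against the negated extreme eigenvalue of
  the other.\<close>

lemma eigval_last_uminus:
  assumes M: "M \<in> carrier_mat n n" "hermitian_mat M" and n: "n > 0"
  shows "eigval n M = - eigval 1 (- M)"
proof -
  have M': "- M \<in> carrier_mat n n" "hermitian_mat (- M)"
    using M hermitian_uminus by auto
  have "- eigval n M \<le> eigval 1 (- M)"
    using eigenvalue_uminus[OF M(1) eigval_last(1)[OF M n]]
    by (intro eigval_first(2)[OF M' n]) simp
  moreover have "eigval n M \<le> - eigval 1 (- M)"
    using eigenvalue_uminus[OF M'(1) eigval_first(1)[OF M' n]]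
    by (intro eigval_last(2)[OF M n]) simp
  ultimately show ?thesis by simp
qed

text \<open>The maximal Rayleigh quotient over all nonzero vectors is attained, and by
  \<open>max_hform_eigenvector\<close> it is an eigenvalue, hence at most the largest one.\<close>

lemma hform_le_eigval_first:
  assumes M: "M \<in> carrier_mat n n" "hermitian_mat M" and x: "x \<in> carrier_vec n"
  shows "hform M x \<le> eigval 1 M * sqnorm x"
\<comment> \<open>The zero case absorbs \<open>n = 0\<close>, where \<open>eigval 1 M\<close> is an
  unspecified entry of the empty list, multiplied by 0.\<close>
proof (cases "x = 0\<^sub>v n")
  case True
  thus ?thesis using M by (simp add: hform_zero sqnorm_zero)
next
  case False
  hence n: "n > 0" using x by (cases n) (auto simp: vec_eq_iff)
  have zero: "hform (0\<^sub>m n n) y = 0" if "y \<in> carrier_vec n" for y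
  proof -
    have "0\<^sub>m n n *\<^sub>v y = 0\<^sub>v n" using that by (auto simp: vec_eq_iff)
    thus ?thesis using that by (simp add: hform_def quad_form_def)
  qed
  \<comment> \<open>with \<open>C = 0\<close> every vector is isotropic\<close>
  obtain u where u: "u \<in> carrier_vec n" "u \<noteq> 0\<^sub>v n"
    and max': "\<And>y. y \<in> carrier_vec n \<Longrightarrow> hform (0\<^sub>m n n) y = 0
      \<Longrightarrow> hform M y \<le> rayleigh M u * sqnorm y"
    by (rule rayleigh_attains_max[OF M(1) zero_carrier_mat x False zero[OF x]]) iprover
  have max: "hform M y \<le> rayleigh M u * sqnorm y" if "y \<in> carrier_vec n" for y
    by (rule max'[OF that zero[OF that]])
  have "hform M u = rayleigh M u * sqnorm u"
    using sqnorm_pos[OF u] u by (simp add: rayleigh_hform)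
  hence "eigenvalue M (complex_of_real (rayleigh M u))"
    using max_hform_eigenvector[OF M u _ max] by blast
  hence "rayleigh M u \<le> eigval 1 M" by (rule eigval_first(2)[OF M n])
  hence "rayleigh M u * sqnorm x \<le> eigval 1 M * sqnorm x"
    using sqnorm_pos[OF x False] by (intro mult_right_mono) auto
  thus ?thesis using max[OF x] by linarith
qed

section \<open>Duality for the pencil\<close>

text \<open>Weak duality: isotropic vectors do not see the multiple of \<open>C\<close>, so the
  Rayleigh bound for the pencil applies to \<open>A\<close>.\<close>

lemma rayleigh_le_eigval_pencil:
  assumes A: "A \<in> carrier_mat n n" "hermitian_mat A"
    and C: "C \<in> carrier_mat n n" "hermitian_mat C"
    and y: "y \<in> carrier_vec n" "y \<noteq> 0\<^sub>v n" "quad_form C y = 0"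
  shows "rayleigh A y \<le> eigval 1 (A - complex_of_real \<nu> \<cdot>\<^sub>m C)"
proof -
  let ?M = "A - complex_of_real \<nu> \<cdot>\<^sub>m C"
  have M: "?M \<in> carrier_mat n n" "hermitian_mat ?M"
    using hermitian_minus_smult[OF A(1) C(1) A(2) C(2)] C
    by (auto intro!: minus_carrier_mat smult_carrier_mat)
  have "hform A y = hform ?M y"
    using y by (simp add: hform_minus_smult[OF A(1) C(1)] hform_def[of C])
  thus ?thesis
    using hform_le_eigval_first[OF M y(1)] sqnorm_pos[OF y(1,2)] y
    by (simp add: rayleigh_hform divide_le_eq)
qed

lemma indefinite_hform:
  assumes "C \<in> carrier_mat n n" "indefinite_mat C"
  obtains y z where "y \<in> carrier_vec n" "hform C y > 0" "z \<in> carrier_vec n" "hform C z < 0"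
proof -
  obtain a b where ab: "a > 0" "eigenvalue C (complex_of_real a)" "b < 0" "eigenvalue C (complex_of_real b)"
    using assms by (auto simp: indefinite_mat_def)
  obtain y where "y \<in> carrier_vec n" "y \<noteq> 0\<^sub>v n" "hform C y = a * sqnorm y"
    using hform_eigenvector[OF assms(1) ab(2)] by blast
  moreover obtain z where "z \<in> carrier_vec n" "z \<noteq> 0\<^sub>v n" "hform C z = b * sqnorm z"
    using hform_eigenvector[OF assms(1) ab(4)] by blast
  ultimately show ?thesis
    using ab sqnorm_pos by (intro that[of y z]) (auto simp: mult_neg_pos)
qed

text \<open>A parameter and an isotropic vector with equal values; the optimality of both then
  follows from weak duality alone.\<close>

lemma pencil_strong_duality:
  assumes A: "A \<in> carrier_mat n n" "hermitian_mat A"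
    and C: "C \<in> carrier_mat n n" "hermitian_mat C" "indefinite_mat C"
  obtains \<mu> x where "x \<in> carrier_vec n" "x \<noteq> 0\<^sub>v n" "quad_form C x = 0"
    and "eigval 1 (A - complex_of_real \<mu> \<cdot>\<^sub>m C) = rayleigh A x"
proof -
  obtain y0 z0 where y0: "y0 \<in> carrier_vec n" "hform C y0 > 0"
    and z0: "z0 \<in> carrier_vec n" "hform C z0 < 0"
    using indefinite_hform[OF C(1,3)] by blast
  obtain x0 where "x0 \<in> carrier_vec n" "x0 \<noteq> 0\<^sub>v n" "hform C x0 = 0"
    using isotropic_exists[OF C(1,2) y0 z0] by blast
  then obtain x where x: "x \<in> carrier_vec n" "x \<noteq> 0\<^sub>v n" "hform C x = 0"
    and max: "\<And>y. y \<in> carrier_vec n \<Longrightarrow> hform C y = 0 \<Longrightarrow> hform A y \<le> rayleigh A x * sqnorm y"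
    using rayleigh_attains_max[OF A(1) C(1)] by blast
  define B where "B = A - complex_of_real (rayleigh A x) \<cdot>\<^sub>m 1\<^sub>m n"
  have B: "B \<in> carrier_mat n n" "hermitian_mat B"
    using A hermitian_minus_smult[OF A(1) one_carrier_mat A(2) hermitian_one]
    by (auto simp: B_def)
  have hB: "hform B y = hform A y - rayleigh A x * sqnorm y" if "y \<in> carrier_vec n" for y
    using hform_minus_smult[OF A(1) one_carrier_mat that] that
    by (simp add: B_def hform_one)
  obtain \<mu> where mu: "\<And>y. y \<in> carrier_vec n \<Longrightarrow> hform B y \<le> \<mu> * hform C y"
    using S_lemma_homogeneous[OF B C(1,2) y0 z0] hB max by fastforce
  let ?M = "A - complex_of_real \<mu> \<cdot>\<^sub>m C"
  have M: "?M \<in> carrier_mat n n" "hermitian_mat ?M"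
    using hermitian_minus_smult[OF A(1) C(1) A(2) C(2)] C
    by (auto intro!: minus_carrier_mat smult_carrier_mat)
  have n: "n > 0" using x by (cases n) (auto simp: vec_eq_iff)
  \<comment> \<open>Testing \<open>B \<le> \<mu> C\<close> at an eigenvector for the largest
    eigenvalue turns the inequality of forms into a bound on that eigenvalue.\<close>
  obtain v where v: "v \<in> carrier_vec n" "v \<noteq> 0\<^sub>v n" "hform ?M v = eigval 1 ?M * sqnorm v"
    using hform_eigenvector[OF M(1) eigval_first(1)[OF M n]] by blast
  have "eigval 1 ?M * sqnorm v \<le> rayleigh A x * sqnorm v"
    using v mu[OF v(1)] hB[OF v(1)] by (simp add: hform_minus_smult[OF A(1) C(1)])
  hence "eigval 1 ?M \<le> rayleigh A x" using sqnorm_pos[OF v(1,2)] by simp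
  \<comment> \<open>\<open>hform C x = 0\<close> concerns the real part only; the form of a
    Hermitian matrix has no imaginary part.\<close>
  moreover have qx: "quad_form C x = 0"
    using x quad_form_hform[OF C(1,2)] by simp
  ultimately have "eigval 1 ?M = rayleigh A x"
    using rayleigh_le_eigval_pencil[OF A C(1,2) x(1,2)] by (meson order_antisym)
  thus ?thesis using that x qx by blast
qed

theorem theorem5p4:
  fixes A C :: "complex mat" and n :: nat
  assumes "A \<in> carrier_mat n n" and "C \<in> carrier_mat n n"
    and "hermitian_mat A" and "hermitian_mat C" and "indefinite_mat C"
  shows "(\<exists>(\<mu>::real) x.
            is_arg_min (\<lambda>\<nu>. eigval 1 (A - complex_of_real \<nu> \<cdot>\<^sub>m C)) (\<lambda>_. True) \<mu> \<and>
            is_arg_max (rayleigh A) (\<lambda>y. y \<in> carrier_vec n \<and> y \<noteq> 0\<^sub>v n \<and> quad_form C y = 0) x \<and>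
            eigval 1 (A - complex_of_real \<mu> \<cdot>\<^sub>m C) = rayleigh A x) \<and>
         (\<exists>(\<mu>::real) x.
            is_arg_max (\<lambda>\<nu>. eigval n (A - complex_of_real \<nu> \<cdot>\<^sub>m C)) (\<lambda>_. True) \<mu> \<and>
            is_arg_min (rayleigh A) (\<lambda>y. y \<in> carrier_vec n \<and> y \<noteq> 0\<^sub>v n \<and> quad_form C y = 0) x \<and>
            eigval n (A - complex_of_real \<mu> \<cdot>\<^sub>m C) = rayleigh A x)"
proof (rule conjI)
  note A = assms(1,3) and C = assms(2,4)
  note weak = rayleigh_le_eigval_pencil[OF _ _ C]
  obtain \<mu> x where x: "x \<in> carrier_vec n" "x \<noteq> 0\<^sub>v n" "quad_form C x = 0"
    and eq: "eigval 1 (A - complex_of_real \<mu> \<cdot>\<^sub>m C) = rayleigh A x"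
    using pencil_strong_duality[OF A C assms(5)] by blast
  \<comment> \<open>Weak duality with \<open>x\<close> fixed makes \<open>\<mu>\<close> a minimizer;
    with \<open>\<mu>\<close> fixed it makes \<open>x\<close> a maximizer, as both values
    agree.\<close>
  have "\<not> eigval 1 (A - complex_of_real \<nu> \<cdot>\<^sub>m C) < rayleigh A x" for \<nu>
    using weak[OF A x] by (simp add: not_less)
  moreover have "\<not> rayleigh A x < rayleigh A y"
    if "y \<in> carrier_vec n" "y \<noteq> 0\<^sub>v n" "quad_form C y = 0" for y
    using weak[OF A that, of \<mu>] eq by simp
  ultimately show "\<exists>(\<mu>::real) x.
      is_arg_min (\<lambda>\<nu>. eigval 1 (A - complex_of_real \<nu> \<cdot>\<^sub>m C)) (\<lambda>_. True) \<mu> \<and>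
      is_arg_max (rayleigh A) (\<lambda>y. y \<in> carrier_vec n \<and> y \<noteq> 0\<^sub>v n \<and> quad_form C y = 0) x \<and>
      eigval 1 (A - complex_of_real \<mu> \<cdot>\<^sub>m C) = rayleigh A x"
    using x eq unfolding is_arg_min_def is_arg_max_def by metis
next
  note A = assms(1,3) and C = assms(2,4)
  have A': "- A \<in> carrier_mat n n" "hermitian_mat (- A)"
    using A hermitian_uminus by auto
  note weak = rayleigh_le_eigval_pencil[OF A' C]
  obtain \<mu> x where x: "x \<in> carrier_vec n" "x \<noteq> 0\<^sub>v n" "quad_form C x = 0"
    and eq: "eigval 1 (- A - complex_of_real \<mu> \<cdot>\<^sub>m C) = rayleigh (- A) x"
    using pencil_strong_duality[OF A' C assms(5)] by blast
  have n: "n > 0" using x by (cases n) (auto simp: vec_eq_iff)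
  \<comment> \<open>Negating the pencil also flips the sign of its parameter, so the maximizer will
    be \<open>- \<mu>\<close>.\<close>
  have eigval: "eigval n (A - complex_of_real \<nu> \<cdot>\<^sub>m C)
      = - eigval 1 (- A - complex_of_real (- \<nu>) \<cdot>\<^sub>m C)" for \<nu>
  proof -
    have "A - complex_of_real \<nu> \<cdot>\<^sub>m C \<in> carrier_mat n n"
      using C by (intro minus_carrier_mat smult_carrier_mat)
    moreover have "- (A - complex_of_real \<nu> \<cdot>\<^sub>m C) = - A - complex_of_real (- \<nu>) \<cdot>\<^sub>m C"
      using A C by (auto simp: mat_eq_iff)
    ultimately show ?thesis
      using eigval_last_uminus[OF _ hermitian_minus_smult[OF A(1) C(1) A(2) C(2)] n] by metis
  qed
  have ray: "rayleigh (- A) y = - rayleigh A y" if "y \<in> carrier_vec n" for y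
    using that A by (simp add: rayleigh_hform hform_uminus)
  have eq': "eigval n (A - complex_of_real (- \<mu>) \<cdot>\<^sub>m C) = rayleigh A x"
    using eq ray[OF x(1)] eigval[of "- \<mu>"] by (simp del: of_real_minus)
  moreover have "\<not> rayleigh A x < eigval n (A - complex_of_real \<nu> \<cdot>\<^sub>m C)" for \<nu>
    using weak[OF x, of "- \<nu>"] ray[OF x(1)] unfolding eigval by simp
  moreover have "\<not> rayleigh A y < rayleigh A x"
    if "y \<in> carrier_vec n" "y \<noteq> 0\<^sub>v n" "quad_form C y = 0" for y
    using weak[OF that, of \<mu>] eq ray[OF that(1)] ray[OF x(1)] by simp
  ultimately show "\<exists>(\<mu>::real) x.
      is_arg_max (\<lambda>\<nu>. eigval n (A - complex_of_real \<nu> \<cdot>\<^sub>m C)) (\<lambda>_. True) \<mu> \<and>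
      is_arg_min (rayleigh A) (\<lambda>y. y \<in> carrier_vec n \<and> y \<noteq> 0\<^sub>v n \<and> quad_form C y = 0) x \<and>
      eigval n (A - complex_of_real \<mu> \<cdot>\<^sub>m C) = rayleigh A x"
    using x unfolding is_arg_min_def is_arg_max_def by metis
qed

end
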